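(* The algorithm GmaxSubmatrix (described in the context) requires exponential time to compute $G_{W_n}^{\max}$ for all even $n \ge 4$, where $$W_n = x_1^{2n} + \dots + x_n^{2n} + x_1^n x_2^n + x_2^n x_3^n + \dots + x_{n-1}^n x_n^n + x_n^n x_1^n .$$ That is, there are constants $c>0$ and $b>1$ such that for every even $n\ge 4$, the algorithm run on the $2n\times n$ exponent matrix of $W_n$ performs at least $c\,b^n$ steps.
   Context: For a polynomial $W = \sum_{i=1}^m c_i\prod_{j=1}^n x_j^{a_{ij}}$ written as a sum of $m$ distinct monomials with nonzero coefficients, the exponent matrix is the $m\times n$ matrix $A=(a_{ij})$. The maximal symmetry group, in additive notation, is $G_W^{\max} = \{\mathbf{g}\in(\mathbb{Q}/\mathbb{Z})^n \mid A\mathbf{g}\in\mathbb{Z}^m\}$. The weight vector $\mathbf{q} = (q_1,\dots,q_n)$ of $W$ is the vector of positive rationals satisfying $A\mathbf{q} = (1,\dots,1)^T$ (it is unique for the polynomials considered; for $W_n$ it is $(\frac1{2n},\dots,\frac1{2n})$), and $\langle\mathbf{q}\rangle$ is the subgroup of $(\mathbb{Q}/\mathbb{Z})^n$ it generates. A submatrix of $A$ is an $n\times n$ matrix consisting of $n$ of the rows of $A$; two submatrices are equivalent if they differ only by a permutation of rows. Algorithm GmaxSubmatrix, on input the $m\times n$ exponent matrix $A$: 1. Set $H := (\mathbb{Q}/\mathbb{Z})^n$. 2. For each submatrix $A_i$ of $A$ (one per equivalence class), in some order: if $A_i$ is invertible, then compute $A_i^{-1}$; generate the subgroup $G_i\le(\mathbb{Q}/\mathbb{Z})^n$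 generated by the columns of $A_i^{-1}$; set $H := H\cap G_i$; and if $|H| = |\langle\mathbf{q}\rangle|$, return $H$ and stop. 3. After the loop has gone through all submatrices, return $H$. Each iteration of the for loop (each submatrix considered, whether invertible or not) counts as at least one step. For $W_n$ the input has $m=2n$ rows, $n$ columns and largest entry $2n$, so it is of polynomial size in $n$. *)

theory Defs
  imports
    Complex_Main
    "HOL-Library.Poly_Mapping"
    "HOL-Algebra.Generated_Groups"
    "Jordan_Normal_Form.Matrix"
    "Jordan_Normal_Form.Gauss_Jordan_Elimination"
begin

section \<open>The group of rationals modulo the integers\<close>

quotient_type rat_mod_int = rat / "\<lambda>x y. x - y \<in> \<int>"
  morphisms rep_qz qz
proof (rule equivpI)
  show "reflp (\<lambda>x y :: rat. x - y \<in> \<int>)"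
    by (simp add: reflp_def)
  show "symp (\<lambda>x y :: rat. x - y \<in> \<int>)"
    by (rule sympI) (metis Ints_minus minus_diff_eq)
  show "transp (\<lambda>x y :: rat. x - y \<in> \<int>)"
  proof (rule transpI)
    fix x y z :: rat
    assume "x - y \<in> \<int>" "y - z \<in> \<int>"
    then have "(x - y) + (y - z) \<in> \<int>" by (rule Ints_add)
    then show "x - z \<in> \<int>" by simp
  qed
qed

instantiation rat_mod_int :: ab_group_add
begin

lift_definition zero_rat_mod_int :: rat_mod_int is "0" .

lift_definition plus_rat_mod_int :: "rat_mod_int \<Rightarrow> rat_mod_int \<Rightarrow> rat_mod_int" is "(+)"
proof -
  fix a b c d :: rat
  assume "a - b \<in> \<int>" "c - d \<in> \<int>"
  then have "(a - b) + (c - d) \<in> \<int>" by (rule Ints_add)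
  then show "(a + c) - (b + d) \<in> \<int>" by (simp add: algebra_simps)
qed

lift_definition uminus_rat_mod_int :: "rat_mod_int \<Rightarrow> rat_mod_int" is "uminus"
proof -
  fix a b :: rat
  assume "a - b \<in> \<int>"
  then have "- (a - b) \<in> \<int>" by (simp only: Ints_minus)
  then show "- a - - b \<in> \<int>" by (simp add: algebra_simps)
qed

lift_definition minus_rat_mod_int :: "rat_mod_int \<Rightarrow> rat_mod_int \<Rightarrow> rat_mod_int" is "(-)"
proof -
  fix a b c d :: rat
  assume "a - b \<in> \<int>" "c - d \<in> \<int>"
  then have "(a - b) - (c - d) \<in> \<int>" by (rule Ints_diff)
  then show "(a - c) - (b - d) \<in> \<int>" by (simp add: algebra_simps)
qed

instance
  by standard (transfer; simp)+

end

text \<open>The group \<open>(\<rat>/\<int>)\<^sup>n\<close> is \<open>monoid_vec TYPE(rat_mod_int) n\<close>, with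
  carrier \<open>carrier_vec n\<close>.\<close>

definition qz_generated :: "nat \<Rightarrow> rat vec set \<Rightarrow> rat_mod_int vec set" where
  "qz_generated n S = generate (monoid_vec TYPE(rat_mod_int) n) (map_vec qz ` S)"


section \<open>Polynomials, exponent matrices and weights\<close>

text \<open>A monomial \<open>nat \<Rightarrow>\<^sub>0 nat\<close> maps the index of a variable to its exponent. A polynomial
  in \<open>n\<close> variables uses the variable indices \<open>0, \<dots>, n - 1\<close>.\<close>

type_synonym mpolynomial = "(nat \<Rightarrow>\<^sub>0 nat) \<Rightarrow>\<^sub>0 complex"

text \<open>The exponent matrix is determined by the polynomial only up to the order in which
  the monomials are written, hence a predicate. The entries are natural numbers, but the
  matrix is taken over the rationals, where its square submatrices are inverted.\<close>

definition is_exponent_matrix :: "nat \<Rightarrow> mpolynomial \<Rightarrow> rat mat \<Rightarrow> bool" where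
  "is_exponent_matrix n W A \<longleftrightarrow>
     (\<exists>ms. distinct ms \<and> set ms = Poly_Mapping.keys W \<and>
       (\<forall>m \<in> set ms. Poly_Mapping.keys m \<subseteq> {..<n}) \<and>
       A = mat (length ms) n (\<lambda>(i, j). of_nat (Poly_Mapping.lookup (ms ! i) j)))"

definition weight_vector :: "rat mat \<Rightarrow> rat vec" where
  "weight_vector A = (THE q. q \<in> carrier_vec (dim_col A) \<and>
     (\<forall>j < dim_col A. 0 < q $ j) \<and> A *\<^sub>v q = vec (dim_row A) (\<lambda>_. 1))"

text \<open>With indices starting at \<open>0\<close>, the successor of the variable \<open>i\<close> in the cycle is
  \<open>(i + 1) mod n\<close>.\<close>

definition W_poly :: "nat \<Rightarrow> mpolynomial" where
  "W_poly n =
     (\<Sum>i<n. Poly_Mapping.single (Poly_Mapping.single i (2 * n)) 1) +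
     (\<Sum>i<n. Poly_Mapping.single
        (Poly_Mapping.single i n + Poly_Mapping.single ((i + 1) mod n) n) 1)"


section \<open>The algorithm\<close>

definition row_submatrix :: "rat mat \<Rightarrow> rat mat \<Rightarrow> bool" where
  "row_submatrix A M \<longleftrightarrow>
     (\<exists>is. distinct is \<and> length is = dim_col A \<and> set is \<subseteq> {..<dim_row A} \<and>
       M = mat_of_rows (dim_col A) (map (row A) is))"

definition row_equivalent :: "rat mat \<Rightarrow> rat mat \<Rightarrow> bool" where
  "row_equivalent M N \<longleftrightarrow> mset (rows M) = mset (rows N)"

text \<open>The possible orders in which the loop may go through the submatrices: lists containing
  exactly one representative of each equivalence class.\<close>

definition submatrix_enumeration :: "rat mat \<Rightarrow> rat mat list \<Rightarrow> bool" where
  "submatrix_enumeration A Ms \<longleftrightarrow>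
     (\<forall>M \<in> set Ms. row_submatrix A M) \<and>
     (\<forall>M. row_submatrix A M \<longrightarrow> (\<exists>!k. k < length Ms \<and> row_equivalent M (Ms ! k)))"

text \<open>The loop returns the computed group together with the number of iterations performed;
  the parameter \<open>d\<close> is the order of the group generated by the weight vector. Counting each
  iteration as a single step is the cheapest admissible cost, so a lower bound for this count
  is a lower bound for every cost model in which an iteration takes at least one step.
  As \<open>card\<close> of an infinite set is \<open>0\<close>, finiteness is tested explicitly.\<close>

fun gmax_loop ::
  "nat \<Rightarrow> nat \<Rightarrow> rat mat list \<Rightarrow> rat_mod_int vec set \<Rightarrow> rat_mod_int vec set \<times> nat" where
  "gmax_loop n d [] H = (H, 0)"
| "gmax_loop n d (M # Ms) H =
     (case mat_inverse M of
        None \<Rightarrow> apsnd Suc (gmax_loop n d Ms H)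
      | Some B \<Rightarrow>
          (let H' = H \<inter> qz_generated n (set (cols B))
           in if finite H' \<and> card H' = d then (H', 1)
              else apsnd Suc (gmax_loop n d Ms H')))"

definition gmax_submatrix :: "rat mat \<Rightarrow> rat mat list \<Rightarrow> rat_mod_int vec set \<times> nat" where
  "gmax_submatrix A Ms =
     gmax_loop (dim_col A) (card (qz_generated (dim_col A) {weight_vector A})) Ms
       (carrier_vec (dim_col A))"

abbreviation gmax_steps :: "rat mat \<Rightarrow> rat mat list \<Rightarrow> nat" where
  "gmax_steps A Ms \<equiv> snd (gmax_submatrix A Ms)"

end

(* The loop never stops early. The group H computed by the loop always contains the maximal
   symmetry group of W_n: if A g is integral, then so is M g for every submatrix M, and
   g = M^-1 (M g) is an integral combination of the columns of M^-1. The maximal symmetry group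
   contains q, and also (1/n, 0, ..., 0), which is not a multiple of q as its coordinates are not
   all equal. So H is always strictly larger than <q>, and the loop runs through
   all (2n choose n) >= 2^n classes of submatrices. *)
theory Submission
  imports Defs
begin

section \<open>Subgroups of (Q/Z)^n generated by rational vectors\<close>

lemma inv_monoid_vec:
  assumes "v \<in> carrier_vec n"
  shows "inv\<^bsub>monoid_vec TYPE('a :: ab_group_add) n\<^esub> v = - v"
proof -
  interpret comm_group "monoid_vec TYPE('a) n" by (rule comm_group_vec)
  show ?thesis
    by (rule inv_equality) (use assms in \<open>auto simp: monoid_vec_simps\<close>)
qed

lemma map_vec_qz_add:
  assumes "u \<in> carrier_vec n" "v \<in> carrier_vec n"
  shows "map_vec qz (u + v) = map_vec qz u + map_vec qz v"
  using assms by (intro eq_vecI) (auto simp: plus_rat_mod_int.abs_eq)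

lemma map_vec_qz_uminus: "map_vec qz (- v) = - map_vec qz v"
  by (intro eq_vecI) (auto simp: uminus_rat_mod_int.abs_eq)

lemma map_vec_qz_zero: "map_vec qz (0\<^sub>v n) = 0\<^sub>v n"
  by (intro eq_vecI) (auto simp: zero_rat_mod_int_def)

lemma subgroup_qz_generated:
  assumes "S \<subseteq> carrier_vec n"
  shows "subgroup (qz_generated n S) (monoid_vec TYPE(rat_mod_int) n)"
proof -
  interpret comm_group "monoid_vec TYPE(rat_mod_int) n" by (rule comm_group_vec)
  show ?thesis
    unfolding qz_generated_def
    by (rule generate_is_subgroup) (use assms in \<open>auto simp: monoid_vec_simps\<close>)
qed

context
  fixes n :: nat and S :: "rat vec set"
  assumes S: "S \<subseteq> carrier_vec n"
begin

lemma qz_generated_zero: "map_vec qz (0\<^sub>v n) \<in> qz_generated n S"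
  using subgroup.one_closed[OF subgroup_qz_generated[OF S]]
  by (simp add: map_vec_qz_zero monoid_vec_simps)

lemma qz_generated_add:
  assumes "u \<in> carrier_vec n" "v \<in> carrier_vec n"
    and "map_vec qz u \<in> qz_generated n S" "map_vec qz v \<in> qz_generated n S"
  shows "map_vec qz (u + v) \<in> qz_generated n S"
  using subgroup.m_closed[OF subgroup_qz_generated[OF S] assms(3,4)] assms(1,2)
  by (simp add: map_vec_qz_add monoid_vec_simps)

lemma qz_generated_uminus:
  assumes "u \<in> carrier_vec n" "map_vec qz u \<in> qz_generated n S"
  shows "map_vec qz (- u) \<in> qz_generated n S"
  using subgroup.m_inv_closed[OF subgroup_qz_generated[OF S] assms(2)] assms(1)
  by (simp add: map_vec_qz_uminus inv_monoid_vec)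

lemma qz_generated_base:
  assumes "u \<in> S"
  shows "map_vec qz u \<in> qz_generated n S"
  unfolding qz_generated_def using assms by (auto intro: generate.incl)

text \<open>The scaling happens on the rational representative, because \<open>rat_mod_int\<close>
  is only an additive group. The induction runs in both directions from 0, adding or subtracting one
  copy of \<open>u\<close> at a time.\<close>

lemma qz_generated_smult_int:
  assumes u: "u \<in> carrier_vec n" and mem: "map_vec qz u \<in> qz_generated n S"
  shows "map_vec qz (of_int z \<cdot>\<^sub>v u) \<in> qz_generated n S"
proof (induction z rule: int_induct[where k = 0])
  case base
  have "of_int 0 \<cdot>\<^sub>v u = 0\<^sub>v n" using u by (intro eq_vecI) auto
  then show ?case using qz_generated_zero by simp
next
  case (step1 i)
  have "of_int (i + 1) \<cdot>\<^sub>v u = of_int i \<cdot>\<^sub>v u + u"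
    using u by (intro eq_vecI) (auto simp: algebra_simps)
  then show ?case using qz_generated_add[OF _ u step1(2) mem] u by simp
next
  case (step2 i)
  have "of_int (i - 1) \<cdot>\<^sub>v u = of_int i \<cdot>\<^sub>v u + (- u)"
    using u by (intro eq_vecI) (auto simp: algebra_simps)
  then show ?case
    using qz_generated_add[OF _ _ step2(2) qz_generated_uminus[OF u mem]] u by simp
qed

end

text \<open>The product \<open>B *\<^sub>v w\<close> is the combination of the columns of
  \<open>B\<close> with the entries of \<open>w\<close> as coefficients, and these are
  integers.\<close>

lemma qz_generated_mult_mat_vec:
  assumes B: "B \<in> carrier_mat n m" and w: "w \<in> carrier_vec m"
    and int: "\<And>i. i < m \<Longrightarrow> w $ i \<in> \<int>"
  shows "map_vec qz (B *\<^sub>v w) \<in> qz_generated n (set (cols B))"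
proof -
  have S: "set (cols B) \<subseteq> carrier_vec n"
    using B by (auto simp: cols_def)
  \<comment> \<open>\<open>p k\<close> is the contribution of the first \<open>k\<close> columns, so
    that \<open>p m\<close> is the whole product and each induction step adds an integer multiple of
    one column.\<close>
  define p where "p k = vec n (\<lambda>i. \<Sum>j<k. B $$ (i, j) * w $ j)" for k
  have "map_vec qz (p k) \<in> qz_generated n (set (cols B))" if "k \<le> m" for k
    using that
  proof (induction k)
    case 0
    have "p 0 = 0\<^sub>v n" by (auto simp: p_def)
    then show ?case using qz_generated_zero[OF S] by simp
  next
    case (Suc k)
    obtain z where z: "w $ k = of_int z"
      using int[of k] Suc.prems by (auto elim: Ints_cases)
    have col: "col B k \<in> carrier_vec n" "col B k \<in> set (cols B)"
      using B Suc.prems by (auto simp: cols_def)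
    have "p (Suc k) = p k + of_int z \<cdot>\<^sub>v col B k"
      using B Suc.prems z by (intro eq_vecI) (auto simp: p_def algebra_simps)
    moreover have "map_vec qz (p k + of_int z \<cdot>\<^sub>v col B k) \<in> qz_generated n (set (cols B))"
      by (rule qz_generated_add[OF S _ _ _
            qz_generated_smult_int[OF S col(1) qz_generated_base[OF S col(2)]]])
        (use Suc col in \<open>auto simp: p_def\<close>)
    ultimately show ?case by simp
  qed
  moreover have "p m = B *\<^sub>v w"
    using B w by (intro eq_vecI) (auto simp: p_def scalar_prod_def atLeast0LessThan)
  ultimately show ?thesis by (metis order_refl)
qed

text \<open>Applied below to the weight vector and to one further symmetry, this keeps both in every
  group that the algorithm intersects with.\<close>

lemma qz_generated_cols_mat_inverse:
  assumes M: "M \<in> carrier_mat n n" and inv: "mat_inverse M = Some B"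
    and v: "v \<in> carrier_vec n" and int: "\<And>i. i < n \<Longrightarrow> row M i \<bullet> v \<in> \<int>"
  shows "map_vec qz v \<in> qz_generated n (set (cols B))"
proof -
  have B: "B * M = 1\<^sub>m n" "B \<in> carrier_mat n n"
    using mat_inverse(2)[OF M inv] by auto
  have "v = B *\<^sub>v (M *\<^sub>v v)"
    using B M v by (metis assoc_mult_mat_vec one_mult_mat_vec)
  moreover have "map_vec qz (B *\<^sub>v (M *\<^sub>v v)) \<in> qz_generated n (set (cols B))"
    by (rule qz_generated_mult_mat_vec[OF B(2)]) (use M v int in auto)
  ultimately show ?thesis by simp
qed

lemma qz_generated_subset:
  assumes "S \<subseteq> carrier_vec n" "\<And>u. u \<in> T \<Longrightarrow> map_vec qz u \<in> qz_generated n S"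
  shows "qz_generated n T \<subseteq> qz_generated n S"
proof -
  interpret comm_group "monoid_vec TYPE(rat_mod_int) n" by (rule comm_group_vec)
  show ?thesis
    unfolding qz_generated_def[of n T]
    by (rule generate_subgroup_incl[OF _ subgroup_qz_generated[OF assms(1)]])
      (use assms(2) in auto)
qed

text \<open>Vectors with all coordinates equal form a subgroup that contains the generator. This is
  the test that shows a symmetry to lie outside the group generated by the weight vector.\<close>

lemma qz_generated_constant:
  assumes x: "x \<in> qz_generated n {vec n (\<lambda>_. a)}" and "i < n" "j < n"
  shows "x $ i = x $ j"
proof -
  let ?D = "{x :: rat_mod_int vec. x \<in> carrier_vec n \<and> (\<exists>c. \<forall>i<n. x $ i = c)}"
  interpret comm_group "monoid_vec TYPE(rat_mod_int) n" by (rule comm_group_vec)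
  have "subgroup ?D (monoid_vec TYPE(rat_mod_int) n)"
    by unfold_locales (auto simp: monoid_vec_simps inv_monoid_vec)
  then have "qz_generated n {vec n (\<lambda>_. a)} \<subseteq> ?D"
    unfolding qz_generated_def by (intro generate_subgroup_incl) auto
  then show ?thesis using assms by auto
qed

section \<open>Runs of the loop without early exit\<close>

lemma gmax_loop_no_early_return:
  assumes "\<And>M B. M \<in> set Ms \<Longrightarrow> mat_inverse M = Some B \<Longrightarrow> K \<subseteq> qz_generated n (set (cols B))"
    and "K \<subseteq> H" and card: "finite K \<Longrightarrow> d < card K"
  shows "snd (gmax_loop n d Ms H) = length Ms"
  using assms(1,2)
proof (induction Ms arbitrary: H)
  case Nil
  then show ?case by simp
next
  case (Cons M Ms)
  show ?case
  proof (cases "mat_inverse M")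
    case None
    have "snd (gmax_loop n d Ms H) = length Ms"
      by (intro Cons.IH) (use Cons.prems in auto)
    then show ?thesis using None by simp
  next
    case (Some B)
    let ?H' = "H \<inter> qz_generated n (set (cols B))"
    \<comment> \<open>The invariant is that \<open>K\<close> lies in the current group.
      \<open>K\<close> may be any set, so no generating set of the maximal symmetry group has to be
      found.\<close>
    have sub: "K \<subseteq> ?H'" using Cons.prems(1)[OF _ Some] Cons.prems(2) by auto
    \<comment> \<open>If \<open>?H'\<close> is finite then so is \<open>K\<close>, and d < card K
      \<le> card \<open>?H'\<close>; if it is infinite, the exit test fails at once.\<close>
    have "\<not> (finite ?H' \<and> card ?H' = d)"
      using card card_mono[OF _ sub] finite_subset[OF sub] by fastforce
    moreover have "snd (gmax_loop n d Ms ?H') = length Ms"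
      using sub by (intro Cons.IH) (use Cons.prems in auto)
    ultimately show ?thesis
      using Some by (auto simp: Let_def)
  qed
qed

section \<open>Submatrices and the number of their classes\<close>

lemma row_submatrix_row:
  assumes "row_submatrix A M"
  shows "M \<in> carrier_mat (dim_col A) (dim_col A)"
    and "i < dim_col A \<Longrightarrow> \<exists>k < dim_row A. row M i = row A k"
proof -
  obtain "is" where "is": "length is = dim_col A" "set is \<subseteq> {..<dim_row A}"
      "M = mat_of_rows (dim_col A) (map (row A) is)"
    using assms unfolding row_submatrix_def by auto
  show "M \<in> carrier_mat (dim_col A) (dim_col A)"
    using "is" by (metis length_map mat_of_rows_carrier(1))
  assume i: "i < dim_col A"
  then have "row M i = row A (is ! i)"
    using "is" by simp
  moreover have "is ! i < dim_row A"
    using "is" i by (metis lessThan_iff nth_mem subsetD)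
  ultimately show "\<exists>k < dim_row A. row M i = row A k" by blast
qed

text \<open>Each set of \<open>dim_col A\<close> row indices gives a submatrix. As the rows of
  \<open>A\<close> are pairwise distinct, different index sets give inequivalent submatrices, which
  occupy different positions of \<open>Ms\<close>.\<close>

lemma submatrix_enumeration_length:
  assumes enum: "submatrix_enumeration A Ms"
    and inj: "inj_on (row A) {..<dim_row A}"
  shows "dim_row A choose dim_col A \<le> length Ms"
proof -
  let ?n = "dim_col A"
  let ?I = "{I. I \<subseteq> {..<dim_row A} \<and> card I = ?n}"
  \<comment> \<open>Sorting the indices selects one representative of the class belonging to
    \<open>I\<close>.\<close>
  define sub where "sub I = mat_of_rows ?n (map (row A) (sorted_list_of_set I))" for I
  have mset: "set_mset (mset (rows (sub I))) = row A ` I" if "I \<in> ?I" for I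
  proof -
    have "finite I" using that finite_subset by auto
    moreover have "rows (sub I) = map (row A) (sorted_list_of_set I)"
      unfolding sub_def by (intro rows_mat_of_rows) auto
    ultimately show ?thesis by simp
  qed
  have "\<exists>k < length Ms. row_equivalent (sub I) (Ms ! k)" if "I \<in> ?I" for I
  proof -
    have "finite I" using that finite_subset by auto
    then have "row_submatrix A (sub I)"
      unfolding row_submatrix_def sub_def using that
      by (intro exI[of _ "sorted_list_of_set I"]) auto
    then show ?thesis using enum unfolding submatrix_enumeration_def by blast
  qed
  then obtain k where k: "\<And>I. I \<in> ?I \<Longrightarrow> k I < length Ms \<and> row_equivalent (sub I) (Ms ! k I)"
    by metis
  have "inj_on k ?I"
  proof (rule inj_onI)
    fix I J assume IJ: "I \<in> ?I" "J \<in> ?I" "k I = k J"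
    \<comment> \<open>Both submatrices are equivalent to the same entry of
      \<open>Ms\<close>.\<close>
    then have "mset (rows (sub I)) = mset (rows (sub J))"
      using k unfolding row_equivalent_def by metis
    then have "row A ` I = row A ` J" using mset IJ by metis
    then show "I = J" using IJ inj by (auto simp: inj_on_image_eq_iff)
  qed
  then have "card ?I \<le> card {..<length Ms}"
    by (rule card_inj_on_le) (use k in auto)
  then show ?thesis using n_subsets[of "{..<dim_row A}" ?n] by simp
qed

section \<open>The monomials of W_n\<close>

lemma Suc_mod_pair_inj:
  fixes n :: nat
  assumes "3 \<le> n" "i < n" "j < n" "{i, (i + 1) mod n} = {j, (j + 1) mod n}"
  shows "i = j"
proof -
  \<comment> \<open>Edges of a cycle are determined by their end points from length 3 on; for n = 2
    both edges would be {0, 1}.\<close>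
  have "(k + 1) mod n = (if k + 1 = n then 0 else k + 1)" if "k < n" for k
    using that by auto
  then show ?thesis using assms by (auto simp: doubleton_eq_iff split: if_splits)
qed

text \<open>The coefficient of a monomial counts its occurrences among the summands, and in
  characteristic zero a positive count is nonzero. Hence nothing cancels, even if summands
  coincide.\<close>

lemma keys_sum_single_one:
  fixes f g :: "'i \<Rightarrow> 'a"
  assumes "finite I"
  shows "Poly_Mapping.keys ((\<Sum>i\<in>I. Poly_Mapping.single (f i) (1 :: 'b :: semiring_char_0)) +
      (\<Sum>i\<in>I. Poly_Mapping.single (g i) 1)) = f ` I \<union> g ` I"
proof -
  have "Poly_Mapping.lookup (\<Sum>i\<in>I. Poly_Mapping.single (h i) (1 :: 'b)) m
      = of_nat (card {i \<in> I. h i = m})" for h :: "'i \<Rightarrow> 'a" and m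
    using assms by (simp add: lookup_sum lookup_single when_def sum.If_cases Int_def)
  then have "Poly_Mapping.lookup ((\<Sum>i\<in>I. Poly_Mapping.single (f i) (1 :: 'b)) +
      (\<Sum>i\<in>I. Poly_Mapping.single (g i) 1)) m
      = of_nat (card {i \<in> I. f i = m} + card {i \<in> I. g i = m})" for m
    by (simp add: lookup_add)
  then show ?thesis
    using assms by (auto simp: in_keys_iff simp del: of_nat_add)
qed

definition power_monomial :: "nat \<Rightarrow> nat \<Rightarrow> (nat \<Rightarrow>\<^sub>0 nat)" where
  "power_monomial n i = Poly_Mapping.single i (2 * n)"

definition cycle_monomial :: "nat \<Rightarrow> nat \<Rightarrow> (nat \<Rightarrow>\<^sub>0 nat)" where
  "cycle_monomial n i = Poly_Mapping.single i n + Poly_Mapping.single ((i + 1) mod n) n"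

lemma keys_W_poly:
  "Poly_Mapping.keys (W_poly n) = power_monomial n ` {..<n} \<union> cycle_monomial n ` {..<n}"
  unfolding W_poly_def power_monomial_def cycle_monomial_def
  by (rule keys_sum_single_one) simp

lemma keys_power_monomial: "0 < n \<Longrightarrow> Poly_Mapping.keys (power_monomial n i) = {i}"
  by (simp add: power_monomial_def)

lemma keys_cycle_monomial:
  "0 < n \<Longrightarrow> Poly_Mapping.keys (cycle_monomial n i) = {i, (i + 1) mod n}"
  by (auto simp: cycle_monomial_def in_keys_iff lookup_add lookup_single when_def split: if_splits)

text \<open>The monomials are told apart by their supports alone: singletons for the powers, pairs
  of cyclic neighbours for the mixed terms.\<close>

lemma card_keys_W_poly:
  assumes "3 \<le> n"
  shows "card (Poly_Mapping.keys (W_poly n)) = 2 * n"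
proof -
  have n: "0 < n" using assms by simp
  have "inj_on (power_monomial n) {..<n}"
    by (rule inj_onI) (metis n keys_power_monomial singleton_inject)
  moreover have "inj_on (cycle_monomial n) {..<n}"
    by (rule inj_onI) (metis n keys_cycle_monomial Suc_mod_pair_inj[OF assms] lessThan_iff)
  moreover have "power_monomial n i \<noteq> cycle_monomial n j" if "j < n" for i j
  proof
    assume "power_monomial n i = cycle_monomial n j"
    then have "j = (j + 1) mod n"
      by (metis n keys_cycle_monomial keys_power_monomial insertI1 insertI2 singletonD)
    then show False using that assms by (cases "j + 1 = n") auto
  qed
  then have "power_monomial n ` {..<n} \<inter> cycle_monomial n ` {..<n} = {}" by auto
  ultimately show ?thesis
    unfolding keys_W_poly by (simp add: card_Un_disjoint card_image)
qed

section \<open>The exponent matrix of W_n and the run of the algorithm on it\<close>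

context
  fixes n :: nat and A :: "rat mat"
  assumes n: "3 \<le> n" and A: "is_exponent_matrix n (W_poly n) A"
begin

lemma exponent_matrix_W_poly_dim: "dim_row A = 2 * n" "dim_col A = n"
  using A card_keys_W_poly[OF n] unfolding is_exponent_matrix_def
  by (auto simp flip: distinct_card)

text \<open>A row records the exponents of the variables below \<open>n\<close>, and all other
  exponents vanish, so it determines its monomial; the monomials are listed without
  repetition.\<close>

lemma exponent_matrix_row_inj: "inj_on (row A) {..<dim_row A}"
proof (rule inj_onI)
  obtain ms where ms: "distinct ms" "\<And>m. m \<in> set ms \<Longrightarrow> Poly_Mapping.keys m \<subseteq> {..<n}"
      "A = mat (length ms) n (\<lambda>(i, j). of_nat (Poly_Mapping.lookup (ms ! i) j))"
    using A unfolding is_exponent_matrix_def by auto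
  fix k l assume kl: "k \<in> {..<dim_row A}" "l \<in> {..<dim_row A}" "row A k = row A l"
  then have len: "k < length ms" "l < length ms" using ms(3) by auto
  have "Poly_Mapping.lookup (ms ! k) j = Poly_Mapping.lookup (ms ! l) j" for j
  proof (cases "j < n")
    case True
    then have "row A k $ j = row A l $ j" using kl(3) by simp
    then show ?thesis using True len by (simp add: ms(3))
  next
    case False
    then have "j \<notin> Poly_Mapping.keys (ms ! k)" "j \<notin> Poly_Mapping.keys (ms ! l)"
      using ms(2) len nth_mem by blast+
    then show ?thesis by (simp add: in_keys_iff)
  qed
  then have "ms ! k = ms ! l" by (intro poly_mapping_eqI)
  then show "k = l" using ms(1) len by (simp add: nth_eq_iff_index_eq)
qed

text \<open>The order of the rows is arbitrary, so the values of all row products are described as a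
  set, not row by row.\<close>

lemma exponent_matrix_row_prod:
  assumes v: "v \<in> carrier_vec n"
  shows "(\<lambda>k. row A k \<bullet> v) ` {..<dim_row A} =
    (\<lambda>i. of_nat (2 * n) * v $ i) ` {..<n} \<union>
    (\<lambda>i. of_nat n * (v $ i + v $ ((i + 1) mod n))) ` {..<n}"
proof -
  obtain ms where ms: "set ms = Poly_Mapping.keys (W_poly n)"
      "A = mat (length ms) n (\<lambda>(i, j). of_nat (Poly_Mapping.lookup (ms ! i) j))"
    using A unfolding is_exponent_matrix_def by auto
  \<comment> \<open>\<open>E m\<close> pairs the exponents of \<open>m\<close> with
    \<open>v\<close>. It is additive in \<open>m\<close>, which reduces the mixed monomials to
    powers of single variables.\<close>
  define E where "E m = (\<Sum>j<n. of_nat (Poly_Mapping.lookup m j) * v $ j)" for m :: "nat \<Rightarrow>\<^sub>0 nat"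
  have E_single: "E (Poly_Mapping.single i a) = of_nat a * v $ i" if "i < n" for i a
    using that by (simp add: E_def lookup_single when_def if_distrib if_distribR
        cong: if_cong)
  have E_add: "E (m + m') = E m + E m'" for m m'
    by (simp add: E_def lookup_add algebra_simps sum.distrib)
  have "(\<lambda>k. row A k \<bullet> v) ` {..<dim_row A} = (\<lambda>k. E (ms ! k)) ` {..<length ms}"
    using v by (intro image_cong) (auto simp: ms(2) E_def scalar_prod_def atLeast0LessThan)
  also have "\<dots> = E ` set ms"
    by (auto simp: set_conv_nth)
  also have "\<dots> = (\<lambda>i. E (power_monomial n i)) ` {..<n} \<union> (\<lambda>i. E (cycle_monomial n i)) ` {..<n}"
    unfolding ms(1) keys_W_poly image_Un image_image ..
  also have "\<dots> = (\<lambda>i. of_nat (2 * n) * v $ i) ` {..<n} \<union>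
      (\<lambda>i. of_nat n * (v $ i + v $ ((i + 1) mod n))) ` {..<n}"
    by (intro arg_cong2[of _ _ _ _ "(\<union>)"] image_cong)
      (auto simp: power_monomial_def cycle_monomial_def E_add E_single algebra_simps)
  finally show ?thesis .
qed

lemma weight_vector_W_poly: "weight_vector A = vec n (\<lambda>_. 1 / of_nat (2 * n))"
  unfolding weight_vector_def exponent_matrix_W_poly_dim
proof (rule the_equality)
  let ?q = "vec n (\<lambda>_. 1 / of_nat (2 * n)) :: rat vec"
  have "row A k \<bullet> ?q = 1" if "k < dim_row A" for k
  proof -
    have "row A k \<bullet> ?q \<in> (\<lambda>k. row A k \<bullet> ?q) ` {..<dim_row A}" using that by simp
    then show ?thesis
      unfolding exponent_matrix_row_prod[OF vec_carrier] using n by (auto simp: field_simps)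
  qed
  then show "?q \<in> carrier_vec n \<and> (\<forall>j<n. 0 < ?q $ j) \<and> A *\<^sub>v ?q = vec (2 * n) (\<lambda>_. 1)"
    using n exponent_matrix_W_poly_dim by (auto intro!: eq_vecI)
next
  fix q :: "rat vec"
  assume q: "q \<in> carrier_vec n \<and> (\<forall>j<n. 0 < q $ j) \<and> A *\<^sub>v q = vec (2 * n) (\<lambda>_. 1)"
  have one: "row A k \<bullet> q = 1" if "k < dim_row A" for k
    using q that exponent_matrix_W_poly_dim by (metis index_mult_mat_vec index_vec)
  \<comment> \<open>The rows of the pure powers already fix every coordinate, which gives
    uniqueness.\<close>
  have "of_nat (2 * n) * q $ i = 1" if "i < n" for i
  proof -
    have "of_nat (2 * n) * q $ i \<in> (\<lambda>k. row A k \<bullet> q) ` {..<dim_row A}"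
      using q that by (subst exponent_matrix_row_prod) auto
    then show ?thesis using one by auto
  qed
  then show "q = vec n (\<lambda>_. 1 / of_nat (2 * n))"
    using q n by (intro eq_vecI) (auto simp: field_simps)
qed

lemma gmax_steps_W_poly:
  assumes sub: "\<And>M. M \<in> set Ms \<Longrightarrow> row_submatrix A M"
  shows "gmax_steps A Ms = length Ms"
proof -
  let ?q = "vec n (\<lambda>_. 1 / of_nat (2 * n)) :: rat vec"
  \<comment> \<open>The row products of \<open>?g\<close> are 2 or 0 for the pure powers and 1 or 0
    for the mixed monomials, hence integral.\<close>
  let ?g = "vec n (\<lambda>i. if i = 0 then 1 / of_nat n else 0) :: rat vec"
  let ?Q = "qz_generated n {?q}"
  \<comment> \<open>One element beyond the group generated by the weights suffices for a strictly
    larger cardinality; \<open>?K\<close> need not be a subgroup.\<close>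
  let ?K = "insert (map_vec qz ?g) ?Q"
  have int: "row A k \<bullet> v \<in> \<int>" if "k < dim_row A" "v \<in> {?q, ?g}" for k v
  proof -
    have v: "v \<in> carrier_vec n" using that by auto
    have "row A k \<bullet> v \<in> (\<lambda>k. row A k \<bullet> v) ` {..<dim_row A}" using that(1) by simp
    then show ?thesis
      unfolding exponent_matrix_row_prod[OF v] using n that(2) by (auto simp: field_simps)
  qed
  have mem: "map_vec qz v \<in> qz_generated n (set (cols B))"
    if "M \<in> set Ms" "mat_inverse M = Some B" "v \<in> {?q, ?g}" for M B v
    using row_submatrix_row[OF sub[OF that(1)]] that int exponent_matrix_W_poly_dim
    by (intro qz_generated_cols_mat_inverse[of M]) fastforce+
  have "?K \<subseteq> qz_generated n (set (cols B))"
    if M: "M \<in> set Ms" "mat_inverse M = Some B" for M B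
  proof -
    have "B \<in> carrier_mat n n"
      using mat_inverse(2)[OF row_submatrix_row(1)[OF sub[OF M(1)]] M(2)]
        exponent_matrix_W_poly_dim by simp
    then have "set (cols B) \<subseteq> carrier_vec n" by (auto simp: cols_def)
    then show ?thesis
      using mem[OF M] qz_generated_subset[of "set (cols B)" n "{?q}"] by simp
  qed
  moreover have "?Q \<subseteq> carrier_vec n"
    using subgroup.subset[OF subgroup_qz_generated[of "{?q}" n]] by (simp add: monoid_vec_simps)
  then have "?K \<subseteq> carrier_vec n" by simp
  moreover have "card ?Q < card ?K" if "finite ?K"
  proof -
    have "1 / rat_of_nat n \<notin> \<int>"
    proof
      assume "1 / rat_of_nat n \<in> \<int>"
      then obtain z where "1 / rat_of_nat n = of_int z" by (auto elim: Ints_cases)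
      moreover have "0 < 1 / rat_of_nat n" "1 / rat_of_nat n < 1" using n by auto
      ultimately show False by simp
    qed
    \<comment> \<open>The class of 1/n in Q/Z is nonzero, while coordinate 1 of \<open>?g\<close> is
      zero.\<close>
    then have "map_vec qz ?g $ 0 \<noteq> map_vec qz ?g $ 1"
      using n by (simp add: rat_mod_int.abs_eq_iff)
    then have "map_vec qz ?g \<notin> ?Q"
      using qz_generated_constant[of "map_vec qz ?g" n _ 0 1] n by auto
    then show ?thesis using that by simp
  qed
  ultimately show ?thesis
    unfolding gmax_submatrix_def weight_vector_W_poly exponent_matrix_W_poly_dim
    by (intro gmax_loop_no_early_return[where K = ?K])
qed

end

theorem theorem3p5:
  shows "\<exists>(c :: real) (b :: real). c > 0 \<and> b > 1 \<and>
    (\<forall>(n :: nat) (A :: rat mat) (Ms :: rat mat list).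
       even n \<and> n \<ge> 4 \<and> is_exponent_matrix n (W_poly n) A \<and> submatrix_enumeration A Ms \<longrightarrow>
       real (gmax_steps A Ms) \<ge> c * b ^ n)"
\<comment> \<open>The constants are c = 1 and b = 2: the bound (N/k)^k \<le> (N choose k) at N = 2n,
  k = n has base 2.\<close>
proof (rule exI[of _ 1], rule exI[of _ 2], intro conjI allI impI)
  fix n :: nat and A :: "rat mat" and Ms :: "rat mat list"
  assume asm: "even n \<and> n \<ge> 4 \<and> is_exponent_matrix n (W_poly n) A \<and> submatrix_enumeration A Ms"
  then have n: "3 \<le> n" and A: "is_exponent_matrix n (W_poly n) A"
    and enum: "submatrix_enumeration A Ms" by auto
  have "(2 :: real) ^ n = (of_nat (2 * n) / of_nat n) ^ n" using n by simp
  also have "\<dots> \<le> of_nat (2 * n choose n)" by (rule binomial_ge_n_over_k_pow_k) simp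
  also have "2 * n choose n \<le> length Ms"
    using submatrix_enumeration_length[OF enum exponent_matrix_row_inj[OF n A]]
      exponent_matrix_W_poly_dim[OF n A] by simp
  also have "length Ms = gmax_steps A Ms"
    using gmax_steps_W_poly[OF n A] enum unfolding submatrix_enumeration_def by simp
  finally show "1 * 2 ^ n \<le> real (gmax_steps A Ms)" by simp
qed simp_all

end
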